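(* Let $G$ be a finite simple graph with vertex set $[n]=\{1,\dots,n\}$. Let $\mathbf{S}$ be any family of subsets of $[n]$ and let $\mathcal{K}(\mathbf{S})$ be the set of $\mathbf{S}$-self-bounding walks on $G$. Then $\mathcal{K}(\mathbf{S})\supseteq\mathcal{B}(G)$ and the set of equivalence classes $C(\mathcal{K}(\mathbf{S}))$ is finite.
   Context: $G[S]$ denotes the subgraph of $G$ induced by $S\subseteq[n]$, whose vertices keep the order inherited from $[n]$. Walks: A walk on a graph is a nonempty finite string of its vertices in which every two successive characters are adjacent. For a walk $w$, $\mathrm{t}(w)$ denotes its last vertex. Self-bounding walks: a walk on a graph $H$ with vertex set contained in $[n]$ is self-bounding if, starting with the set of forbidden vertices consisting of just its starting vertex, in each step the walk (i) proceeds from the current vertex $i$ to a neighbor $j$ of $i$ in $H$ that is not currently forbidden, and (ii) adds to the set of forbidden vertices all neighbors of $i$ in $H$ that are greater than or equal to $j$. Forbidden vertices remain forbidden. $\mathcal{B}(H)$ is the set of self-bounding walks on $H$ (including single-vertex walks). $\mathbf{S}$-self-bounding walks: every (nonempty) contiguous substring of a walk $w$ is called a subwalk of $w$. Given $S\subseteq[n]$, the $S$-restriction of a walk $w$ is the set of subwalks of $w$ whose vertices are all in $S$. A walk $w$ on $G$ is self-bounding within $S$ if every walk in the $S$-restriction of $w$ is in $\mathcal{B}(G[S])$. Given a family $\mathbf{S}=\{S_1,\dots,S_q\}$ of subsets of $[n]$, a walk is $\mathbf{S}$-self-bounding if it is self-bounding within $S_i$ for every $i\in[q]$. Equivalence classes: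 for a set of walks $\mathcal{W}$ and $w,w'\in\mathcal{W}$, write $w\sim w'$ if $\mathrm{t}(w)=\mathrm{t}(w')$ and $\{z: wz\in\mathcal{W}\}=\{z: w'z\in\mathcal{W}\}$, where $z$ ranges over strings over $[n]$ and $wz$ is concatenation. $C(\mathcal{W})$ is the set of equivalence classes of $\sim$ on $\mathcal{W}$. *)

theory Defs
  imports "Graph_Theory.Graph_Theory" "HOL-Library.Sublist"
begin

text \<open>
  Graphs are taken from the AFP entry Graph_Theory: an undirected edge is a pair of opposite arcs,
  and the locale predicate \<^const>\<open>graph\<close> describes finite digraphs that are symmetric,
  loop-free and without parallel arcs, that is, finite simple graphs.
  Walks are the vertex walks \<^const>\<open>vwalk\<close>, which are nonempty by definition.
\<close>

text \<open>
  \<open>self_bounding_from H F i w\<close>: a walk that is currently at vertex \<open>i\<close> with set \<open>F\<close> of forbidden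
  vertices can be continued by the vertices \<open>w\<close>. In a step from \<open>i\<close> to \<open>j\<close> it is the
  neighbours of the vertex being left, \<open>i\<close>, that become forbidden, and \<open>j\<close> itself is one of them.
\<close>
fun self_bounding_from ::
    "(nat, 'b) pre_digraph \<Rightarrow> nat set \<Rightarrow> nat \<Rightarrow> nat list \<Rightarrow> bool" where
  "self_bounding_from H F i [] \<longleftrightarrow> True"
| "self_bounding_from H F i (j # w) \<longleftrightarrow>
     i \<rightarrow>\<^bsub>H\<^esub> j \<and> j \<notin> F \<and>
     self_bounding_from H (F \<union> {k. i \<rightarrow>\<^bsub>H\<^esub> k \<and> k \<ge> j}) j w"

definition self_bounding_walks :: "(nat, 'b) pre_digraph \<Rightarrow> nat list set" where
  "self_bounding_walks H = {w. vwalk w H \<and> self_bounding_from H {hd w} (hd w) (tl w)}"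

definition walk_restriction :: "nat set \<Rightarrow> nat list \<Rightarrow> nat list set" where
  "walk_restriction S w = {v. v \<noteq> [] \<and> sublist v w \<and> set v \<subseteq> S}"

definition self_bounding_within :: "(nat, 'b) pre_digraph \<Rightarrow> nat set \<Rightarrow> nat list \<Rightarrow> bool" where
  "self_bounding_within G S w \<longleftrightarrow> walk_restriction S w \<subseteq> self_bounding_walks (G \<restriction> S)"

definition family_self_bounding_walks ::
    "(nat, 'b) pre_digraph \<Rightarrow> nat set set \<Rightarrow> nat list set" where
  "family_self_bounding_walks G SS = {w. vwalk w G \<and> (\<forall>S\<in>SS. self_bounding_within G S w)}"

text \<open>The parameter \<open>A\<close> is the alphabet over which the continuation strings range.\<close>
definition walk_equiv :: "nat set \<Rightarrow> nat list set \<Rightarrow> (nat list \<times> nat list) set" where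
  "walk_equiv A W = {(w, w'). w \<in> W \<and> w' \<in> W \<and> last w = last w' \<and>
     {z \<in> lists A. w @ z \<in> W} = {z \<in> lists A. w' @ z \<in> W}}"

definition walk_classes :: "nat set \<Rightarrow> nat list set \<Rightarrow> nat list set set" where
  "walk_classes A W = W // walk_equiv A W"

lemma equiv_walk_equiv: "equiv W (walk_equiv A W)"
  by (rule equivI) (auto simp: walk_equiv_def refl_on_def sym_def trans_def)

end

theory Submission
  imports Defs
begin

text \<open>
  Whether \<open>w @ z\<close> is self-bounding within \<open>S\<close> depends, besides \<open>z\<close> and the last vertex of \<open>w\<close>,
  only on the sets of vertices forbidden after the suffixes of \<open>w\<close> that lie in \<open>S\<close>. These are
  subsets of \<open>{1..n}\<close>, so a walk is classified by one of finitely many states. The inclusion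
  holds because a walk forbids at least as many vertices as any of its subwalks does.
\<close>

fun forbidden_after :: "(nat, 'b) pre_digraph \<Rightarrow> nat set \<Rightarrow> nat \<Rightarrow> nat list \<Rightarrow> nat set" where
  "forbidden_after H F i [] = F"
| "forbidden_after H F i (j # w) = forbidden_after H (F \<union> {k. i \<rightarrow>\<^bsub>H\<^esub> k \<and> k \<ge> j}) j w"

lemma self_bounding_from_append:
  "self_bounding_from H F i (u @ p) \<longleftrightarrow> self_bounding_from H F i u \<and>
     self_bounding_from H (forbidden_after H F i u) (last (i # u)) p"
  by (induction u arbitrary: F i) auto

lemma forbidden_after_subset:
  assumes "wf_digraph G" "F \<subseteq> verts G"
  shows "forbidden_after G F i w \<subseteq> verts G"
  using assms(2)
proof (induction w arbitrary: F i)
  case (Cons j w)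
  have "F \<union> {k. i \<rightarrow>\<^bsub>G\<^esub> k \<and> k \<ge> j} \<subseteq> verts G"
    using Cons.prems wf_digraph.adj_in_verts[OF assms(1)] by blast
  from Cons.IH[OF this] show ?case by simp
qed simp

lemma dominates_induce_subgraph:
  "i \<rightarrow>\<^bsub>G \<restriction> S\<^esub> j \<longleftrightarrow> i \<rightarrow>\<^bsub>G\<^esub> j \<and> i \<in> S \<and> j \<in> S"
  by (auto simp: arcs_ends_def arc_to_ends_def)

lemma self_bounding_from_imp_arcs:
  "self_bounding_from H F i w \<Longrightarrow> set (vwalk_arcs (i # w)) \<subseteq> arcs_ends H"
  by (induction w arbitrary: F i) auto

text \<open>Every step of \<open>self_bounding_from\<close> already checks adjacency, so of
  \<open>vwalk\<close> only nonemptiness and membership of the vertices remain to be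
  required.\<close>

lemma self_bounding_walks_iff:
  "w \<in> self_bounding_walks H \<longleftrightarrow>
     w \<noteq> [] \<and> set w \<subseteq> verts H \<and> self_bounding_from H {hd w} (hd w) (tl w)"
  using self_bounding_from_imp_arcs[of H "{hd w}" "hd w" "tl w"]
  by (cases w) (auto simp: self_bounding_walks_def vwalk_def)

lemma self_bounding_walks_append:
  assumes "v \<noteq> []"
  shows "v @ p \<in> self_bounding_walks H \<longleftrightarrow> v \<in> self_bounding_walks H \<and> set p \<subseteq> verts H \<and>
    self_bounding_from H (forbidden_after H {hd v} (hd v) (tl v)) (last v) p"
  using assms by (cases v) (auto simp: self_bounding_walks_iff self_bounding_from_append)

text \<open>Passing to an induced subgraph removes neighbours, so each step forbids fewer vertices
  and the inclusion \<open>F' \<subseteq> F\<close> is preserved. This is why the two runs carry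
  separate forbidden sets.\<close>

lemma self_bounding_from_induce_subgraph:
  assumes "self_bounding_from G F i w" "F' \<subseteq> F" "i \<in> S" "set w \<subseteq> S"
  shows "self_bounding_from (G \<restriction> S) F' i w"
  using assms
proof (induction w arbitrary: F F' i)
  case (Cons j w)
  have "self_bounding_from (G \<restriction> S) (F' \<union> {k. i \<rightarrow>\<^bsub>G \<restriction> S\<^esub> k \<and> k \<ge> j}) j w"
    using Cons.prems by (intro Cons.IH) (auto simp: dominates_induce_subgraph)
  with Cons.prems show ?case by (auto simp: dominates_induce_subgraph)
qed simp

text \<open>A step to \<open>x\<close> forbids \<open>x\<close> itself, because \<open>x\<close> is
  a neighbour of the vertex being left and \<open>x \<ge> x\<close>. Hence the forbidden set on
  arrival contains the initial set \<open>{x}\<close> of a walk started afresh at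
  \<open>x\<close>.\<close>

lemma self_bounding_from_drop:
  assumes "self_bounding_from G F i (a @ x # v)"
  shows "\<exists>F'. x \<in> F' \<and> self_bounding_from G F' x v"
  using assms
proof (induction a arbitrary: F i)
  case Nil
  then show ?case by (intro exI[of _ "F \<union> {k. i \<rightarrow>\<^bsub>G\<^esub> k \<and> k \<ge> x}"]) simp
qed auto

lemma self_bounding_walks_sublist:
  assumes w: "w \<in> self_bounding_walks G" and v: "v \<in> walk_restriction S w"
  shows "v \<in> self_bounding_walks (G \<restriction> S)"
proof -
  from v obtain a b x u where u: "v = x # u" and w': "w = a @ x # u @ b" and S: "set (x # u) \<subseteq> S"
    by (cases v) (auto simp: walk_restriction_def sublist_def)
  \<comment> \<open>With nothing before \<open>x\<close>, the initial forbidden set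
    \<open>{x}\<close> serves; otherwise \<open>x\<close> is reached by a step.\<close>
  have "\<exists>F. x \<in> F \<and> self_bounding_from G F x (u @ b)"
  proof (cases a)
    case Nil
    with w w' show ?thesis by (intro exI[of _ "{x}"]) (simp add: self_bounding_walks_iff)
  next
    case (Cons i a')
    with w w' show ?thesis
      using self_bounding_from_drop by (fastforce simp: self_bounding_walks_iff)
  qed
  then obtain F where "x \<in> F" "self_bounding_from G F x u"
    by (auto simp: self_bounding_from_append)
  \<comment> \<open>The forbidden set shrinks to \<open>{x}\<close> at the same time as the graph
    shrinks to the induced subgraph.\<close>
  then have "self_bounding_from (G \<restriction> S) {x} x u"
    using S by (intro self_bounding_from_induce_subgraph) auto
  with S u show ?thesis by (simp add: self_bounding_walks_iff)
qed

lemma self_bounding_walks_subset_family: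
  "self_bounding_walks G \<subseteq> family_self_bounding_walks G SS"
  using self_bounding_walks_sublist
  by (auto simp: family_self_bounding_walks_def self_bounding_within_def self_bounding_walks_def)

text \<open>Only suffixes of \<open>w\<close> can grow into new subwalks when \<open>w\<close> is
  extended. Each forbidden set is tagged with its \<open>S\<close>, since the run continues in the
  subgraph induced by \<open>S\<close>; the current vertex is always \<open>last w\<close> and is
  not stored.\<close>

definition forbidden_states ::
    "(nat, 'b) pre_digraph \<Rightarrow> nat set set \<Rightarrow> nat list \<Rightarrow> (nat set \<times> nat set) set" where
  "forbidden_states G SS w =
     {(S, forbidden_after (G \<restriction> S) {hd v} (hd v) (tl v)) | S v.
        S \<in> SS \<and> v \<noteq> [] \<and> suffix v w \<and> set v \<subseteq> S}"

lemma walk_restriction_append: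
  "walk_restriction S (w @ z) = walk_restriction S w \<union> walk_restriction S z \<union>
     {v @ p | v p. v \<noteq> [] \<and> suffix v w \<and> set v \<subseteq> S \<and> prefix p z \<and> set p \<subseteq> S}"
  (is "?L = ?R")
proof (intro equalityI subsetI)
  fix u assume u: "u \<in> ?L"
  then have "sublist u w \<or> sublist u z \<or> (\<exists>v p. u = v @ p \<and> suffix v w \<and> prefix p z)"
    by (simp add: walk_restriction_def sublist_append)
  \<comment> \<open>If the part in \<open>w\<close> is empty, then \<open>u\<close> is a prefix of
    \<open>z\<close> and belongs to the second case, so the third may assume \<open>v\<close>
    nonempty.\<close>
  then consider "sublist u w" | "sublist u z"
    | v p where "u = v @ p" "suffix v w" "prefix p z" "v \<noteq> []"
    by (metis append_Nil prefix_imp_sublist)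
  then show "u \<in> ?R"
  proof cases
    case 3
    with u have "set v \<subseteq> S" "set p \<subseteq> S" by (simp_all add: walk_restriction_def)
    with 3 show ?thesis by blast
  qed (use u in \<open>simp_all add: walk_restriction_def\<close>)
next
  fix u assume "u \<in> ?R"
  then consider "u \<in> walk_restriction S w" | "u \<in> walk_restriction S z"
    | v p where "u = v @ p" "v \<noteq> []" "suffix v w" "set v \<subseteq> S" "prefix p z" "set p \<subseteq> S"
    by blast
  then show "u \<in> ?L"
  proof cases
    case 3
    then have "sublist u (w @ z)" unfolding sublist_append by blast
    with 3 show ?thesis by (simp add: walk_restriction_def)
  qed (simp_all add: walk_restriction_def sublist_append)
qed

text \<open>Subwalks of \<open>w\<close> are covered by the assumption and those of \<open>z\<close>
  do not involve \<open>w\<close>, so \<open>w\<close> matters only through the subwalks that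
  straddle the junction.\<close>

lemma self_bounding_within_append:
  assumes "self_bounding_within G S w" "S \<in> SS"
  shows "self_bounding_within G S (w @ z) \<longleftrightarrow> self_bounding_within G S z \<and>
    (\<forall>F p. (S, F) \<in> forbidden_states G SS w \<and> prefix p z \<and> set p \<subseteq> S \<longrightarrow>
       self_bounding_from (G \<restriction> S) F (last w) p)"
proof -
  \<comment> \<open>The part \<open>v\<close> is a subwalk of \<open>w\<close> and so already
    self-bounding; what remains is the run of \<open>p\<close> from the state that \<open>v\<close>
    leaves behind.\<close>
  have straddle: "v @ p \<in> self_bounding_walks (G \<restriction> S) \<longleftrightarrow>
      self_bounding_from (G \<restriction> S) (forbidden_after (G \<restriction> S) {hd v} (hd v) (tl v)) (last w) p"
    if "v \<noteq> []" "suffix v w" "set v \<subseteq> S" "set p \<subseteq> S" for v p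
  proof -
    have "v \<in> self_bounding_walks (G \<restriction> S)"
      using that assms by (auto simp: self_bounding_within_def walk_restriction_def)
    moreover have "last v = last w"
      using that by (auto simp: suffix_def)
    ultimately show ?thesis
      using that by (simp add: self_bounding_walks_append)
  qed
  have "self_bounding_within G S (w @ z) \<longleftrightarrow> self_bounding_within G S z \<and>
      (\<forall>v p. v \<noteq> [] \<and> suffix v w \<and> set v \<subseteq> S \<and> prefix p z \<and> set p \<subseteq> S \<longrightarrow>
         v @ p \<in> self_bounding_walks (G \<restriction> S))"
    using assms(1)
    by (simp add: self_bounding_within_def walk_restriction_append) blast
  also have "\<dots> \<longleftrightarrow> self_bounding_within G S z \<and>
    (\<forall>F p. (S, F) \<in> forbidden_states G SS w \<and> prefix p z \<and> set p \<subseteq> S \<longrightarrow>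
       self_bounding_from (G \<restriction> S) F (last w) p)"
    using assms(2) by (auto simp: forbidden_states_def straddle)
  finally show ?thesis .
qed

lemma vwalk_append_iff:
  assumes "vwalk w G"
  shows "vwalk (w @ z) G \<longleftrightarrow> z = [] \<or> vwalk z G \<and> last w \<rightarrow>\<^bsub>G\<^esub> hd z"
  using assms
proof (induction w rule: vwalk_arcs.induct)
  case (2 x)
  then show ?case by (cases z) (auto simp: vwalk_def)
next
  case (3 x y xs)
  then show ?case by (auto simp: vwalk_def)
qed (simp add: vwalk_def)

lemma append_mem_family_cong:
  assumes "w \<in> family_self_bounding_walks G SS" "w' \<in> family_self_bounding_walks G SS"
    and "last w = last w'" "forbidden_states G SS w = forbidden_states G SS w'"
  shows "w @ z \<in> family_self_bounding_walks G SS \<longleftrightarrow> w' @ z \<in> family_self_bounding_walks G SS"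
proof -
  \<comment> \<open>The right-hand side mentions \<open>u\<close> only through \<open>last u\<close>
    and \<open>forbidden_states G SS u\<close>, on which \<open>w\<close> and \<open>w'\<close>
    agree.\<close>
  have "u @ z \<in> family_self_bounding_walks G SS \<longleftrightarrow>
      (z = [] \<or> vwalk z G \<and> last u \<rightarrow>\<^bsub>G\<^esub> hd z) \<and>
      (\<forall>S\<in>SS. self_bounding_within G S z \<and>
        (\<forall>F p. (S, F) \<in> forbidden_states G SS u \<and> prefix p z \<and> set p \<subseteq> S \<longrightarrow>
           self_bounding_from (G \<restriction> S) F (last u) p))"
    if "u \<in> family_self_bounding_walks G SS" for u
  proof -
    from that have u: "vwalk u G" and within: "\<And>S. S \<in> SS \<Longrightarrow> self_bounding_within G S u"
      by (simp_all add: family_self_bounding_walks_def)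
    show ?thesis
      unfolding family_self_bounding_walks_def mem_Collect_eq vwalk_append_iff[OF u]
      using self_bounding_within_append[OF within] by (intro arg_cong2[of _ _ _ _ "(\<and>)"] ball_cong refl)
  qed
  from this[OF assms(1)] this[OF assms(2)] show ?thesis
    by (simp only: assms(3,4))
qed

text \<open>The run on a suffix takes place in the subgraph induced by \<open>S\<close>, whose
  vertex set is \<open>S\<close>, so it forbids nothing outside \<open>S\<close>.\<close>

lemma forbidden_states_subset:
  assumes "wf_digraph G"
  shows "forbidden_states G SS w \<subseteq> Sigma SS Pow"
proof -
  have "forbidden_after (G \<restriction> S) {hd v} (hd v) (tl v) \<subseteq> S" if "v \<noteq> []" "set v \<subseteq> S" for S v
  proof -
    have "{hd v} \<subseteq> verts (G \<restriction> S)"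
      using that hd_in_set[of v] by auto
    from forbidden_after_subset[OF wf_digraph.wellformed_induce_subgraph[OF assms] this]
    show ?thesis by simp
  qed
  then show ?thesis unfolding forbidden_states_def by blast
qed

text \<open>Sending a value of \<open>f\<close> to the class of a chosen preimage reaches every
  class.\<close>

lemma finite_quotient_if_finite_image:
  assumes "finite (f ` A)" and "\<And>x y. x \<in> A \<Longrightarrow> y \<in> A \<Longrightarrow> f x = f y \<Longrightarrow> r `` {x} = r `` {y}"
  shows "finite (A // r)"
proof -
  have "A // r \<subseteq> (\<lambda>s. r `` {inv_into A f s}) ` f ` A"
  proof
    fix X assume "X \<in> A // r"
    then obtain x where x: "x \<in> A" "X = r `` {x}" by (auto elim: quotientE)
    then have "X = r `` {inv_into A f (f x)}"
      using assms(2)[of x "inv_into A f (f x)"] by (simp add: inv_into_into f_inv_into_f)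
    with x show "X \<in> (\<lambda>s. r `` {inv_into A f s}) ` f ` A" by blast
  qed
  with assms(1) show ?thesis by (meson finite_imageI finite_subset)
qed

lemma finite_walk_classes_family:
  assumes "graph G" and SS: "SS \<subseteq> Pow (verts G)"
  shows "finite (walk_classes A (family_self_bounding_walks G SS))" (is "finite (walk_classes A ?W)")
proof -
  interpret graph G by fact
  let ?f = "\<lambda>w. (last w, forbidden_states G SS w)"
  have states: "?f ` ?W \<subseteq> verts G \<times> Pow (Sigma SS Pow)"
  proof
    fix s assume "s \<in> ?f ` ?W"
    then obtain w where "vwalk w G" "s = ?f w"
      by (auto simp: family_self_bounding_walks_def)
    then show "s \<in> verts G \<times> Pow (Sigma SS Pow)"
      using forbidden_states_subset[OF wf_digraph_axioms] last_in_set[of w]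
      by (auto simp: vwalk_def)
  qed
  have "finite SS"
    using SS finite_verts by (meson finite_Pow_iff finite_subset)
  moreover have "finite S" if "S \<in> SS" for S
    using that SS finite_verts by (meson Pow_iff finite_subset subsetD)
  ultimately have "finite (verts G \<times> Pow (Sigma SS Pow))"
    using finite_verts by (intro finite_cartesian_product finite_SigmaI iffD2[OF finite_Pow_iff])
  with states have "finite (?f ` ?W)" by (rule finite_subset)
  then show ?thesis
    unfolding walk_classes_def
  proof (rule finite_quotient_if_finite_image)
    fix w w' assume "w \<in> ?W" "w' \<in> ?W" "?f w = ?f w'"
    \<comment> \<open>Equal states allow the same continuations among all strings, hence among those
      over any alphabet \<open>A\<close>.\<close>
    then have "(w, w') \<in> walk_equiv A ?W"
      using append_mem_family_cong[of w G SS w'] by (auto simp: walk_equiv_def)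
    then show "walk_equiv A ?W `` {w} = walk_equiv A ?W `` {w'}"
      by (rule equiv_class_eq[OF equiv_walk_equiv])
  qed
qed

theorem theorem4:
  fixes n :: nat and G :: "(nat, 'b) pre_digraph" and SS :: "nat set set"
  assumes "graph G"
    and "verts G = {1..n}"
    and "SS \<subseteq> Pow {1..n}"
  shows "self_bounding_walks G \<subseteq> family_self_bounding_walks G SS \<and>
    finite (walk_classes {1..n} (family_self_bounding_walks G SS))"
  using self_bounding_walks_subset_family[of G SS]
    finite_walk_classes_family[OF assms(1), of SS "{1..n}"] assms(2,3)
  by simp

end
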